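(* Let $(P,\preceq)$ be a locally finite lattice and $f:P\to\mathbb{C}$. Let $X=\{x_1,\dots,x_n\}$ and $Y=\{y_1,\dots,y_n\}$ be subsets of $P$, indexed so that $x_i\preceq x_j\Rightarrow i\le j$ and $y_i\preceq y_j\Rightarrow i\le j$. Let $D=\{d_1,\dots,d_m\}$ be any finite subset of $P$ containing all elements $x_i\vee y_j$, indexed so that $d_i\preceq d_j\Rightarrow i\le j$. Then: (i) if $n>m$, then $\det[X,Y]_f=0$; (ii) if $n\le m$, then $$\det[X,Y]_f=\sum_{1\le k_1<k_2<\cdots<k_n\le m}\det E(X)_{(k_1,\dots,k_n)}\,\det E(Y)_{(k_1,\dots,k_n)}\,\Psi_{D,f}(d_{k_1})\Psi_{D,f}(d_{k_2})\cdots\Psi_{D,f}(d_{k_n}).$$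
   Context: $[X,Y]_f$ denotes the $n\times n$ matrix with $(i,j)$ entry $f(x_i\vee y_j)$. The function $\Psi_{D,f}$ on $D$ is defined recursively by $\Psi_{D,f}(d_k)=f(d_k)-\sum_{d_v\in D,\ d_k\prec d_v}\Psi_{D,f}(d_v)$, equivalently $f(d_k)=\sum_{d_v\in D,\ d_k\preceq d_v}\Psi_{D,f}(d_v)$. $E(X)$ is the $n\times m$ matrix with $(i,j)$ entry $1$ if $x_i\preceq d_j$ and $0$ otherwise; $E(Y)$ is defined likewise with $y_i$ in place of $x_i$. For an $n\times m$ matrix $A$ and $1\le k_1<\dots<k_n\le m$, $A_{(k_1,\dots,k_n)}$ is the $n\times n$ submatrix of $A$ consisting of columns $k_1,\dots,k_n$. *)

theory Defs
  imports "Jordan_Normal_Form.Determinant"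
begin

text \<open>Matrices are indexed from 0, so the informal indices \<open>1, \<dots>, n\<close> become \<open>0, \<dots>, n - 1\<close>.\<close>

definition join_matrix ::
  "nat \<Rightarrow> (nat \<Rightarrow> 'a::lattice) \<Rightarrow> (nat \<Rightarrow> 'a) \<Rightarrow> ('a \<Rightarrow> complex) \<Rightarrow> complex mat" where
  "join_matrix n x y f = mat n n (\<lambda>(i, j). f (sup (x i) (y j)))"

definition incidence_matrix ::
  "nat \<Rightarrow> nat \<Rightarrow> (nat \<Rightarrow> 'a::order) \<Rightarrow> (nat \<Rightarrow> 'a) \<Rightarrow> complex mat" where
  "incidence_matrix n m x d = mat n m (\<lambda>(i, j). if x i \<le> d j then 1 else 0)"

definition column_submatrix :: "'a mat \<Rightarrow> nat list \<Rightarrow> 'a mat" where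
  "column_submatrix A ks = mat_of_cols (dim_row A) (map (col A) ks)"

definition increasing_tuples :: "nat \<Rightarrow> nat \<Rightarrow> nat list set" where
  "increasing_tuples n m = {ks. length ks = n \<and> sorted_wrt (<) ks \<and> set ks \<subseteq> {..<m}}"

text \<open>Only finite \<open>D\<close> and arguments in \<open>D\<close> are meaningful; the finiteness test serves termination.\<close>

function Psi :: "'a::order set \<Rightarrow> ('a \<Rightarrow> complex) \<Rightarrow> 'a \<Rightarrow> complex" where
  "Psi D f d = (if finite D then f d - (\<Sum>v\<in>{v \<in> D. d < v}. Psi D f v) else 0)"
  by pat_completeness auto
termination
proof (relation "measure (\<lambda>(D, f, d). card {v \<in> D. d < v})")
  fix D :: "'a set" and f :: "'a \<Rightarrow> complex" and d v :: 'a
  assume "finite D" and v: "v \<in> {v \<in> D. d < v}"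
  then have "{w \<in> D. v < w} \<subset> {w \<in> D. d < w}"
    by (auto intro: less_trans)
  then show "((D, f, v), (D, f, d)) \<in> measure (\<lambda>(D, f, d). card {v \<in> D. d < v})"
    using \<open>finite D\<close> by (simp add: psubset_card_mono)
qed simp

declare Psi.simps [simp del]

lemma sum_Psi_above:
  assumes "finite D" and "d \<in> D"
  shows "(\<Sum>v\<in>{v \<in> D. d \<le> v}. Psi D f v) = f d"
proof -
  have "{v \<in> D. d \<le> v} = insert d {v \<in> D. d < v}"
    using assms(2) by (auto simp: order.order_iff_strict)
  then show ?thesis
    using assms(1) by (simp add: Psi.simps [of D f d])
qed

end

theory Submission
  imports Defs
begin

text \<open>
  Every join of an \<open>x i\<close> with a \<open>y j\<close> lies in \<open>D\<close>, so Moebius inversion gives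
  \<open>f (sup (x i) (y j)) = (\<Sum>v\<in>D. [x i \<le> v] [y j \<le> v] Psi D f v)\<close>; the join matrix is thus
  \<open>E(X) diag(Psi) E(Y)\<close> with the last factor transposed, and the theorem is the Cauchy-Binet formula
  for this product.  For Cauchy-Binet, multilinearity expands the determinant over all maps
  \<open>g : {0..<n} \<rightarrow> {0..<m}\<close>; non-injective maps contribute nothing, and an injective map is an
  increasing tuple composed with a permutation.  If \<open>n > m\<close> there are no injective maps.
\<close>

lemma increasing_tuplesD:
  assumes "ks \<in> increasing_tuples n m"
  shows "length ks = n" "sorted_wrt (<) ks" "distinct ks" "set ks \<subseteq> {0..<m}"
  using assms by (auto simp: increasing_tuples_def strict_sorted_iff)

lemma increasing_tuples_empty:
  assumes "m < n"
  shows "increasing_tuples n m = {}"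
proof -
  have False if "ks \<in> increasing_tuples n m" for ks
    using increasing_tuplesD[OF that] card_mono[of "{0..<m}" "set ks"] assms
    by (simp add: distinct_card)
  then show ?thesis by auto
qed

lemma index_column_submatrix:
  assumes "A \<in> carrier_mat n m" "ks \<in> increasing_tuples n m" "i < n" "j < n"
  shows "column_submatrix A ks $$ (i, j) = A $$ (i, ks ! j)"
proof -
  have "ks ! j < m"
    using increasing_tuplesD[OF assms(2)] assms(4) nth_mem[of j ks] by fastforce
  then show ?thesis
    using assms increasing_tuplesD[OF assms(2)]
    by (auto simp: column_submatrix_def mat_of_cols_index)
qed

lemma column_submatrix_carrier:
  assumes "A \<in> carrier_mat n m" "ks \<in> increasing_tuples n m"
  shows "column_submatrix A ks \<in> carrier_mat n n"
  using assms increasing_tuplesD[OF assms(2)] by (auto simp: column_submatrix_def)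

text \<open>An injective map is determined by its image, listed increasingly as \<open>ks\<close>,
  and by the order \<open>p\<close> in which it visits the entries. Applying \<open>restrict\<close>
  picks the extensional representative, so that the target consists of the choice functions that
  \<open>prod_sum_PiE\<close> yields in the Cauchy-Binet expansion.\<close>

lemma bij_betw_tuple_permutation:
  "bij_betw (\<lambda>(ks, p). restrict (\<lambda>i. ks ! p i) {0..<n})
     (increasing_tuples n m \<times> {p. p permutes {0..<n}})
     {g \<in> {0..<n} \<rightarrow>\<^sub>E {0..<m}. inj_on g {0..<n}}"
  (is "bij_betw ?h ?A ?B")
proof (rule bij_betw_imageI)
  \<comment> \<open>The permutation only reorders positions, so the image forgets \<open>p\<close>;
    this is how \<open>ks\<close> is recovered from the composite.\<close>
  have image: "(\<lambda>i. ks ! p i) ` {0..<n} = set ks"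
    if "ks \<in> increasing_tuples n m" "p permutes {0..<n}" for ks p
  proof -
    have "(\<lambda>i. ks ! p i) ` {0..<n} = (!) ks ` (p ` {0..<n})" by auto
    also have "\<dots> = set ks"
      using permutes_image[OF that(2)] increasing_tuplesD(1)[OF that(1)]
      by (auto simp: set_conv_nth)
    finally show ?thesis .
  qed
  show "inj_on ?h ?A"
  proof (rule inj_onI, clarify)
    fix ks p ls q
    assume ks: "ks \<in> increasing_tuples n m" and p: "p permutes {0..<n}"
      and ls: "ls \<in> increasing_tuples n m" and q: "q permutes {0..<n}"
      and eq: "restrict (\<lambda>i. ks ! p i) {0..<n} = restrict (\<lambda>i. ls ! q i) {0..<n}"
    have pt: "ks ! p i = ls ! q i" if "i < n" for i
      using fun_cong[OF eq, of i] that by simp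
    then have "(\<lambda>i. ks ! p i) ` {0..<n} = (\<lambda>i. ls ! q i) ` {0..<n}" by auto
    then have "set ks = set ls" using image[OF ks p] image[OF ls q] by simp
    then have [simp]: "ls = ks"
      using strict_sorted_equal increasing_tuplesD(2)[OF ks] increasing_tuplesD(2)[OF ls] by metis
    \<comment> \<open>Below \<open>n\<close>, the distinctness of the entries of \<open>ks\<close>
      lets the position be read off from the value; elsewhere both permutations are the
      identity.\<close>
    have "p i = q i" for i
    proof (cases "i < n")
      case True
      then have "p i < n" "q i < n" using permutes_in_image[OF p] permutes_in_image[OF q] by auto
      then show ?thesis
        using pt[OF True] increasing_tuplesD[OF ks] by (simp add: nth_eq_iff_index_eq)
    next
      case False
      then show ?thesis using p q by (simp add: permutes_def)
    qed
    then show "ks = ls \<and> p = q" by auto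
  qed
  show "?h ` ?A = ?B"
  proof (intro equalityI subsetI)
    fix g assume "g \<in> ?h ` ?A"
    then obtain ks p where ks: "ks \<in> increasing_tuples n m" and p: "p permutes {0..<n}"
      and g: "g = restrict (\<lambda>i. ks ! p i) {0..<n}" by auto
    have "p i < n" if "i < n" for i using permutes_in_image[OF p] that by auto
    moreover have "ks ! i < m" if "i < n" for i
      using increasing_tuplesD[OF ks] that nth_mem[of i ks] by fastforce
    moreover have "inj_on g {0..<n}"
      unfolding g using increasing_tuplesD[OF ks] permutes_inj[OF p] calculation(1)
      by (auto simp: inj_on_def nth_eq_iff_index_eq)
    ultimately show "g \<in> ?B" by (auto simp: g)
  next
    fix g assume "g \<in> ?B"
    then have g: "g \<in> {0..<n} \<rightarrow>\<^sub>E {0..<m}" and inj: "inj_on g {0..<n}" by auto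
    define ks where "ks = sorted_list_of_set (g ` {0..<n})"
    have len: "length ks = n" by (simp add: ks_def card_image[OF inj])
    have set: "set ks = g ` {0..<n}" by (simp add: ks_def)
    have ks: "ks \<in> increasing_tuples n m"
      using g set len by (auto simp: increasing_tuples_def ks_def)
    have nth: "bij_betw ((!) ks) {0..<n} (g ` {0..<n})"
      using bij_betw_nth[of ks "{0..<n}" "g ` {0..<n}"] increasing_tuplesD(3)[OF ks] len set
      by (simp add: atLeast0LessThan)
    \<comment> \<open>The position of \<open>g i\<close> in the sorted image. The identity outside
      the range is what \<open>permutes\<close> demands.\<close>
    define p where "p i = (if i < n then inv_into {0..<n} ((!) ks) (g i) else i)" for i
    have "bij_betw (inv_into {0..<n} ((!) ks) \<circ> g) {0..<n} {0..<n}"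
      using inj bij_betw_inv_into[OF nth] by (intro bij_betw_trans) (auto intro: inj_on_imp_bij_betw)
    then have "bij_betw p {0..<n} {0..<n}"
      by (rule bij_betw_cong[THEN iffD1, rotated]) (simp add: p_def)
    then have p: "p permutes {0..<n}"
      by (rule bij_imp_permutes) (simp add: p_def)
    have "ks ! p i = g i" if "i < n" for i
      using that bij_betw_inv_into_right[OF nth, of "g i"] by (simp add: p_def)
    then have "g = ?h (ks, p)" using g by (fastforce simp: PiE_def extensional_def)
    then show "g \<in> ?h ` ?A" using ks p by blast
  qed
qed

text \<open>The weights \<open>w\<close> are the entries of the diagonal middle factor, kept inside
  the sum so that no triple matrix product is needed. No relation between \<open>n\<close> and
  \<open>m\<close> is assumed: for \<open>m < n\<close> the right-hand side is an empty sum.\<close>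

theorem Cauchy_Binet_weighted:
  fixes A B :: "'a::comm_ring_1 mat"
  assumes A: "A \<in> carrier_mat n m" and B: "B \<in> carrier_mat n m"
  shows "det (mat n n (\<lambda>(i, j). \<Sum>k=0..<m. A $$ (i, k) * B $$ (j, k) * w k)) =
    (\<Sum>ks\<in>increasing_tuples n m.
      det (column_submatrix A ks) * det (column_submatrix B ks) * (\<Prod>k\<leftarrow>ks. w k))"
  (is "det ?M = _")
proof -
  let ?P = "{p. p permutes {0..<n}}"
  let ?G = "{0..<n} \<rightarrow>\<^sub>E {0..<m}"
  let ?I = "{g \<in> ?G. inj_on g {0..<n}}"
  \<comment> \<open>Row \<open>i\<close> of \<open>?M\<close> is a combination of the columns of
    \<open>B\<close>, column \<open>k\<close> having coefficient \<open>A $$ (i, k) * w k\<close>.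
    Choosing column \<open>g i\<close> for each row \<open>i\<close> leaves the matrix
    \<open>R g\<close>, and \<open>F g\<close> is its determinant times the chosen
    coefficients.\<close>
  define R where "R g = mat n n (\<lambda>(i, j). B $$ (j, g i))" for g :: "nat \<Rightarrow> nat"
  define F where "F g = (\<Prod>i=0..<n. A $$ (i, g i) * w (g i)) * det (R g)" for g
  have R: "R g \<in> carrier_mat n n" for g by (simp add: R_def)
  have "det ?M = (\<Sum>p\<in>?P. signof p *
      (\<Prod>i=0..<n. \<Sum>k=0..<m. A $$ (i, k) * B $$ (p i, k) * w k))"
    by (subst det_def'[of _ n]) (auto intro!: sum.cong arg_cong2[of _ _ _ _ "(*)"] prod.cong)
  also have "\<dots> = (\<Sum>p\<in>?P. signof p *
      (\<Sum>g\<in>?G. \<Prod>i=0..<n. A $$ (i, g i) * B $$ (p i, g i) * w (g i)))"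
    by (simp add: prod_sum_PiE)
  also have "\<dots> = (\<Sum>g\<in>?G. \<Sum>p\<in>?P. signof p *
      (\<Prod>i=0..<n. A $$ (i, g i) * B $$ (p i, g i) * w (g i)))"
    by (simp add: sum_distrib_left sum.swap[of _ ?G])
  also have "\<dots> = (\<Sum>g\<in>?G. F g)"
  proof (rule sum.cong)
    fix g
    have "det (R g) = (\<Sum>p\<in>?P. signof p * (\<Prod>i=0..<n. B $$ (p i, g i)))"
      by (subst det_def'[OF R])
        (auto simp: R_def intro!: sum.cong arg_cong2[of _ _ _ _ "(*)"] prod.cong)
    then show "(\<Sum>p\<in>?P. signof p *
        (\<Prod>i=0..<n. A $$ (i, g i) * B $$ (p i, g i) * w (g i))) = F g"
      by (simp add: F_def sum_distrib_left prod.distrib mult_ac)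
  qed simp
  also have "\<dots> = (\<Sum>g\<in>?I. F g)"
  proof (rule sum.mono_neutral_right)
    show "finite ?G" by (intro finite_PiE) auto
    show "\<forall>g\<in>?G - ?I. F g = 0"
    proof
      fix g assume "g \<in> ?G - ?I"
      \<comment> \<open>A repeated value of \<open>g\<close> selects the same column of
        \<open>B\<close> for two different rows of \<open>R g\<close>.\<close>
      then obtain i j where ij: "i < n" "j < n" "i \<noteq> j" "g i = g j"
        by (auto simp: inj_on_def)
      then have "row (R g) i = row (R g) j" by (auto simp: R_def)
      then have "det (R g) = 0" using det_identical_rows[OF R] ij by blast
      then show "F g = 0" by (simp add: F_def)
    qed
  qed auto
  also have "\<dots> = (\<Sum>(ks, p)\<in>increasing_tuples n m \<times> ?P.
      F (restrict (\<lambda>i. ks ! p i) {0..<n}))"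
    by (subst sum.reindex_bij_betw[OF bij_betw_tuple_permutation, symmetric])
      (simp add: case_prod_beta)
  also have "\<dots> = (\<Sum>ks\<in>increasing_tuples n m. \<Sum>p\<in>?P.
      F (restrict (\<lambda>i. ks ! p i) {0..<n}))"
    by (simp add: sum.cartesian_product)
  also have "\<dots> = (\<Sum>ks\<in>increasing_tuples n m.
      det (column_submatrix A ks) * det (column_submatrix B ks) * (\<Prod>k\<leftarrow>ks. w k))"
  proof (rule sum.cong)
    fix ks assume ks: "ks \<in> increasing_tuples n m"
    let ?A = "column_submatrix A ks" and ?B = "column_submatrix B ks"
    note cA = column_submatrix_carrier[OF A ks] and cB = column_submatrix_carrier[OF B ks]
    \<comment> \<open>For fixed \<open>ks\<close>, each \<open>p\<close> contributes one Leibniz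
      term of \<open>det ?A\<close>, times a factor free of \<open>p\<close>. The sign of that term
      is supplied by \<open>det (R ?g)\<close>.\<close>
    have "F (restrict (\<lambda>i. ks ! p i) {0..<n}) =
        signof p * (\<Prod>i=0..<n. ?A $$ (i, p i)) * (det ?B * (\<Prod>k\<leftarrow>ks. w k))"
      if p: "p permutes {0..<n}" for p
    proof -
      let ?g = "restrict (\<lambda>i. ks ! p i) {0..<n}"
      have pn: "p i < n" if "i < n" for i using permutes_in_image[OF p] that by auto
      \<comment> \<open>Following \<open>ks\<close> by way of \<open>p\<close> amounts to permuting
        the rows of the transpose of \<open>?B\<close>.\<close>
      have "R ?g = mat n n (\<lambda>(i, j). transpose_mat ?B $$ (p i, j))"
        using cB pn by (auto simp: R_def index_column_submatrix[OF B ks])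
      then have "det (R ?g) = signof p * det ?B"
        using det_permute_rows[OF _ p, of "transpose_mat ?B"] det_transpose[OF cB] cB by simp
      moreover have "(\<Prod>i=0..<n. w (?g i)) = (\<Prod>k\<leftarrow>ks. w k)"
      proof -
        have "(\<Prod>i=0..<n. w (?g i)) = (\<Prod>i=0..<n. w (ks ! p i))" by simp
        also have "\<dots> = (\<Prod>i=0..<n. w (ks ! i))"
          using prod.permute[OF p, of "\<lambda>i. w (ks ! i)"] by (simp add: o_def)
        also have "\<dots> = (\<Prod>k\<leftarrow>ks. w k)"
          using increasing_tuplesD(1)[OF ks] by (simp add: prod.list_conv_set_nth)
        finally show ?thesis .
      qed
      moreover have "(\<Prod>i=0..<n. A $$ (i, ?g i)) = (\<Prod>i=0..<n. ?A $$ (i, p i))"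
        by (rule prod.cong) (auto simp: index_column_submatrix[OF A ks] pn)
      ultimately show ?thesis
        by (simp add: F_def prod.distrib mult_ac del: restrict_apply)
    qed
    then show "(\<Sum>p\<in>?P. F (restrict (\<lambda>i. ks ! p i) {0..<n})) =
        det ?A * det ?B * (\<Prod>k\<leftarrow>ks. w k)"
      by (simp add: det_def'[OF cA] sum_distrib_right mult.assoc)
  qed simp
  finally show ?thesis .
qed

text \<open>By the universal property of the join, \<open>sup (x i) (y j)\<close> lies below
  \<open>v\<close> iff both \<open>x i\<close> and \<open>y j\<close> do, so its indicator factors
  into one entry of each incidence matrix. Membership of the joins in the range of \<open>d\<close>
  is what allows \<open>sum_Psi_above\<close> to be applied.\<close>

lemma join_matrix_eq_incidence:
  fixes x y d :: "nat \<Rightarrow> 'a::lattice"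
  assumes inj: "inj_on d {0..<m}"
    and joins: "\<And>i j. \<lbrakk>i < n; j < n\<rbrakk> \<Longrightarrow> sup (x i) (y j) \<in> d ` {0..<m}"
  shows "join_matrix n x y f = mat n n (\<lambda>(i, j). \<Sum>k=0..<m.
    incidence_matrix n m x d $$ (i, k) * incidence_matrix n m y d $$ (j, k) *
    Psi (d ` {0..<m}) f (d k))"
proof (rule eq_matI)
  let ?D = "d ` {0..<m}"
  fix i j
  assume "i < dim_row (mat n n (\<lambda>(i, j). \<Sum>k=0..<m.
    incidence_matrix n m x d $$ (i, k) * incidence_matrix n m y d $$ (j, k) * Psi ?D f (d k)))"
    and "j < dim_col (mat n n (\<lambda>(i, j). \<Sum>k=0..<m.
    incidence_matrix n m x d $$ (i, k) * incidence_matrix n m y d $$ (j, k) * Psi ?D f (d k)))"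
  then have ij: "i < n" "j < n" by auto
  have "f (sup (x i) (y j)) = (\<Sum>v\<in>{v \<in> ?D. sup (x i) (y j) \<le> v}. Psi ?D f v)"
    using joins[OF ij] by (intro sum_Psi_above[symmetric]) auto
  also have "\<dots> = (\<Sum>v\<in>?D. if sup (x i) (y j) \<le> v then Psi ?D f v else 0)"
    by (simp add: sum.inter_filter)
  \<comment> \<open>Injectivity of \<open>d\<close> ensures that no element of \<open>?D\<close> is
    counted twice when the sum runs over indices.\<close>
  also have "\<dots> = (\<Sum>k=0..<m. if sup (x i) (y j) \<le> d k then Psi ?D f (d k) else 0)"
    by (simp add: sum.reindex[OF inj])
  also have "\<dots> = (\<Sum>k=0..<m. incidence_matrix n m x d $$ (i, k) *
      incidence_matrix n m y d $$ (j, k) * Psi ?D f (d k))"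
    using ij by (intro sum.cong) (auto simp: incidence_matrix_def)
  finally show "join_matrix n x y f $$ (i, j) = mat n n (\<lambda>(i, j). \<Sum>k=0..<m.
      incidence_matrix n m x d $$ (i, k) * incidence_matrix n m y d $$ (j, k) *
      Psi ?D f (d k)) $$ (i, j)"
    using ij by (simp add: join_matrix_def)
qed (auto simp: join_matrix_def)

theorem theorem4p1:
  fixes f :: "'a::lattice \<Rightarrow> complex"
    and n m :: nat
    and x y d :: "nat \<Rightarrow> 'a"
    and D :: "'a set"
  assumes locally_finite: "\<And>a b :: 'a. finite {a..b}"
    and x_indexed: "\<And>i j. \<lbrakk>i < n; j < n; x i \<le> x j\<rbrakk> \<Longrightarrow> i \<le> j"
    and y_indexed: "\<And>i j. \<lbrakk>i < n; j < n; y i \<le> y j\<rbrakk> \<Longrightarrow> i \<le> j"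
    and D_eq: "D = d ` {..<m}"
    and d_indexed: "\<And>i j. \<lbrakk>i < m; j < m; d i \<le> d j\<rbrakk> \<Longrightarrow> i \<le> j"
    and joins_in_D: "\<And>i j. \<lbrakk>i < n; j < n\<rbrakk> \<Longrightarrow> sup (x i) (y j) \<in> D"
  shows "(n > m \<longrightarrow> det (join_matrix n x y f) = 0) \<and>
    (n \<le> m \<longrightarrow>
      det (join_matrix n x y f) =
        (\<Sum>ks\<in>increasing_tuples n m.
          det (column_submatrix (incidence_matrix n m x d) ks) *
          det (column_submatrix (incidence_matrix n m y d) ks) *
          (\<Prod>k\<leftarrow>ks. Psi D f (d k))))"
proof -
  have D: "D = d ` {0..<m}" using D_eq by (simp add: atLeast0LessThan)
  \<comment> \<open>Equal values are comparable in both directions, so the indexing condition forces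
    both inequalities between their indices.\<close>
  have "inj_on d {0..<m}"
    using d_indexed by (intro inj_onI) (simp add: order_antisym)
  then have "det (join_matrix n x y f) =
      (\<Sum>ks\<in>increasing_tuples n m.
        det (column_submatrix (incidence_matrix n m x d) ks) *
        det (column_submatrix (incidence_matrix n m y d) ks) *
        (\<Prod>k\<leftarrow>ks. Psi D f (d k)))"
    using joins_in_D unfolding D
    by (subst join_matrix_eq_incidence)
      (auto simp: incidence_matrix_def intro!: Cauchy_Binet_weighted)
  \<comment> \<open>The same formula settles both cases: for \<open>n > m\<close> there is no
    increasing tuple, and the sum is zero.\<close>
  then show ?thesis by (simp add: increasing_tuples_empty)
qed

end
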